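(* Let $(B,d)$ be a metric space and $f:B\to\mathbb{R}$ a function. The following conditions are equivalent. (a) $f$ is Baire-1. (b) There is a continuous function $\overline{f}:B\times\mathbb{R}_{>0}\to\mathbb{R}$ such that for every $b\in B$ and every $C>0$, $\overline{f}(b',t)\to f(b)$ as $(b',t)\to(b,0)$ with $b'\in B$, $t>0$ and $d(b,b')\le Ct$. (c) For some metric space $(B',d)$ containing $(B,d)$ isometrically, there is a continuous function $\overline{f}:B'\times\mathbb{R}_{>0}\to\mathbb{R}$ such that for every $b\in B$ and every $C>0$, $\overline{f}(b',t)\to f(b)$ as $(b',t)\to(b,0)$ with $b'\in B'$, $t>0$ and $d(b,b')\le Ct$. (c') For every metric space $(B',d)$ containing $(B,d)$ isometrically, there is a continuous function $\overline{f}:B'\times\mathbb{R}_{>0}\to\mathbb{R}$ with the property stated in (c).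
   Context: A function between metrizable spaces is Baire-1 if the preimage of every open set is $F_\sigma$, i.e. a countable union of closed sets. Explicitly, the convergence in (b) means: for all $b\in B$, $C>0$ and $\varepsilon>0$ there is $\delta>0$ such that $|\overline{f}(b',t)-f(b)|<\varepsilon$ whenever $0<t<\delta$ and $b'\in B$ satisfies $d(b,b')\le Ct$; similarly in (c), (c') with $b'$ ranging over $B'$ (and $b$ still over $B$). *)

theory Defs
  imports "HOL-Analysis.Analysis"
begin

definition baire1_map :: "'a topology \<Rightarrow> 'b topology \<Rightarrow> ('a \<Rightarrow> 'b) \<Rightarrow> bool" where
  "baire1_map X Y f \<longleftrightarrow>
     f \<in> topspace X \<rightarrow> topspace Y \<and>
     (\<forall>U. openin Y U \<longrightarrow> fsigma_in X {x \<in> topspace X. f x \<in> U})"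

text \<open>
  Isometric embeddings need not be surjective. They model an isometric inclusion of \<open>B\<close> in \<open>B'\<close>,
  with \<open>i b\<close> as the copy of \<open>b\<close> in \<open>B'\<close>.

  HOL cannot quantify over types inside a formula, so in order to speak of some or of every metric
  space containing \<open>B :: 'a metric\<close>, one lets \<open>B'\<close> range over \<open>('a + 'c) metric\<close> with \<open>'c\<close> a free
  type variable. A metric space with points in \<open>'c\<close> is isometric, through \<open>Inr\<close>, to one with points
  in \<open>'a + 'c\<close>, so as \<open>'c\<close> varies all spaces are covered. The summand \<open>'a\<close> ensures that a copy of
  \<open>B\<close> itself is always among them; over a type \<open>'c\<close> that is too small, the quantifiers over \<open>B'\<close>
  would be vacuous.
\<close>

definition isometric_embedding :: "'a metric \<Rightarrow> 'b metric \<Rightarrow> ('a \<Rightarrow> 'b) \<Rightarrow> bool" where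
  "isometric_embedding B B' i \<longleftrightarrow>
     i \<in> mspace B \<rightarrow> mspace B' \<and>
     (\<forall>x\<in>mspace B. \<forall>y\<in>mspace B. mdist B' (i x) (i y) = mdist B x y)"

text \<open>
  \<open>F (b', t) \<rightarrow> f b\<close> as \<open>(b', t) \<rightarrow> (b, 0)\<close> inside every cone \<open>d (b, b') \<le> C * t\<close>, \<open>t > 0\<close>. Since
  \<open>b'\<close> is forced towards \<open>b\<close> by the cone condition, only \<open>t\<close> has to be bounded by \<open>\<delta>\<close>.
\<close>

definition conical_limit ::
  "'a metric \<Rightarrow> 'b metric \<Rightarrow> ('a \<Rightarrow> 'b) \<Rightarrow> ('a \<Rightarrow> real) \<Rightarrow> ('b \<times> real \<Rightarrow> real) \<Rightarrow> bool" where
  "conical_limit B B' i f F \<longleftrightarrow>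
     (\<forall>b\<in>mspace B. \<forall>C>0. \<forall>\<epsilon>>0. \<exists>\<delta>>0. \<forall>t b'.
        0 < t \<and> t < \<delta> \<and> b' \<in> mspace B' \<and> mdist B' (i b) b' \<le> C * t
          \<longrightarrow> \<bar>F (b', t) - f b\<bar> < \<epsilon>)"

abbreviation half_space_topology :: "'a metric \<Rightarrow> ('a \<times> real) topology" where
  "half_space_topology B \<equiv> prod_topology (mtopology_of B) (top_of_set {0<..})"

end

theory Submission
  imports Defs
begin

text \<open>
  If \<open>F\<close> has conical limit \<open>f\<close>, then \<open>f\<close> is the pointwise limit of the continuous functions
  \<open>F (i b, 1 / (n + 1))\<close>, and pointwise limits of continuous functions are Baire-1.

  Conversely, cover \<open>B\<close> by countably many closed sets \<open>C n\<close> on which \<open>f\<close> takes values in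
  \<open>[q n, r n]\<close>, in such a way that every point lies in sets \<open>C n\<close> with arbitrarily short interval.
  Let \<open>w n (b', t)\<close> be a continuous weight in \<open>[0, 1]\<close> that vanishes if \<open>n * t \<ge> 2\<close> and that, in
  every cone over a point \<open>b\<close>, is eventually \<open>1\<close> if \<open>b\<close> lies in \<open>C n\<close> and eventually \<open>0\<close> otherwise.
  Starting with the value \<open>0\<close>, clamp with weight \<open>w n\<close> to \<open>[q n, r n]\<close>, the large indices \<open>n\<close> first;
  the result is \<open>F (b', t)\<close>. If \<open>b\<close> lies in \<open>C k\<close>, then near \<open>(b, 0)\<close> step \<open>k\<close> puts the value into
  \<open>[q k, r k]\<close>, an interval that contains \<open>f b\<close>, and each later step \<open>n < k\<close> either does nothing
  or does not move the value away from \<open>f b\<close>.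
\<close>

section \<open>Pointwise limits of continuous functions\<close>

text \<open>The closed sets \<open>K m\<close>, whose points keep distance at least
  \<open>1 / (m + 1)\<close> from the complement, exhaust \<open>U\<close>. So the limit lies in
  \<open>U\<close> exactly if, for some \<open>m\<close>, the values \<open>g n x\<close> eventually
  stay in \<open>K m\<close>.\<close>

lemma baire1_map_pointwise_limit:
  fixes g :: "nat \<Rightarrow> 'a \<Rightarrow> real"
  assumes cont: "\<And>n. continuous_map X euclideanreal (g n)"
    and lim: "\<And>x. x \<in> topspace X \<Longrightarrow> (\<lambda>n. g n x) \<longlonglongrightarrow> f x"
  shows "baire1_map X euclideanreal f"
  unfolding baire1_map_def
proof (intro conjI allI impI)
  show "f \<in> topspace X \<rightarrow> topspace euclideanreal"
    by simp
  fix U :: "real set"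
  assume "openin euclideanreal U"
  then have U: "open U"
    by simp
  define K where "K m = (\<Inter>z\<in>-U. {y. 1 / real (Suc m) \<le> dist y z})" for m
  have K: "closed (K m)" for m
    unfolding K_def by (intro closed_INT ballI closed_Collect_le continuous_intros)
  define D where "D m k = topspace X \<inter> (\<Inter>n\<in>{k..}. {x \<in> topspace X. g n x \<in> K m})" for m k
  have D: "closedin X (D m k)" for m k
    unfolding D_def using K cont
    by (intro closedin_Int closedin_INT closedin_continuous_map_preimage[of X euclideanreal]) auto
  have "{x \<in> topspace X. f x \<in> U} = (\<Union>(m, k)\<in>UNIV. D m k)"
  proof (intro equalityI subsetI)
    fix x assume x: "x \<in> {x \<in> topspace X. f x \<in> U}"
    then obtain e where e: "e > 0" "ball (f x) e \<subseteq> U"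
      using U open_contains_ball by blast
    obtain m where m: "1 / real (Suc m) < e / 2"
      using nat_approx_posE[of "e/2"] e(1) by (metis half_gt_zero)
    have "\<forall>\<^sub>F n in sequentially. dist (g n x) (f x) < e / 2"
      using lim x e(1) by (intro tendstoD) auto
    then obtain k where k: "\<And>n. n \<ge> k \<Longrightarrow> dist (g n x) (f x) < e / 2"
      by (auto simp: eventually_sequentially)
    have "1 / real (Suc m) \<le> dist (g n x) z" if "n \<ge> k" "z \<notin> U" for n z
    proof -
      have "dist (f x) z \<ge> e"
        using that(2) e(2) by (meson mem_ball not_less subsetD)
      then show ?thesis
        using k[OF that(1)] m dist_triangle2[of "f x" z "g n x"]
        by (simp add: dist_commute)
    qed
    then have "x \<in> D m k"
      using x unfolding D_def K_def by blast
    then show "x \<in> (\<Union>(m, k)\<in>UNIV. D m k)"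
      by auto
  next
    fix x assume "x \<in> (\<Union>(m, k)\<in>UNIV. D m k)"
    then obtain m k where x: "x \<in> topspace X" and g: "\<And>n. n \<ge> k \<Longrightarrow> g n x \<in> K m"
      by (auto simp: D_def)
    have "f x \<in> K m"
      using K _ _ lim[OF x]
      by (rule Lim_in_closed_set) (use g in \<open>auto simp: eventually_sequentially\<close>)
    have "f x \<in> U"
    proof (rule ccontr)
      assume "f x \<notin> U"
      with \<open>f x \<in> K m\<close> have "1 / real (Suc m) \<le> dist (f x) (f x)"
        unfolding K_def by blast
      then show False
        by simp
    qed
    with x show "x \<in> {x \<in> topspace X. f x \<in> U}"
      by simp
  qed
  moreover have "fsigma_in X (\<Union>(m, k)\<in>UNIV. D m k)"
    using D by (intro fsigma_in_Union countable_image) (auto intro: closed_imp_fsigma_in)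
  ultimately show "fsigma_in X {x \<in> topspace X. f x \<in> U}"
    by simp
qed

lemma baire1_map_if_conical_limit:
  assumes i: "isometric_embedding B B' i"
    and F: "continuous_map (half_space_topology B') euclideanreal F"
    and lim: "conical_limit B B' i f F"
  shows "baire1_map (mtopology_of B) euclideanreal f"
proof (rule baire1_map_pointwise_limit)
  have iB: "i b \<in> mspace B'" if "b \<in> mspace B" for b
    using i that by (auto simp: isometric_embedding_def)
  have "Lipschitz_continuous_map B B' i"
    using i unfolding isometric_embedding_def Lipschitz_continuous_map_def
    by (auto intro!: exI[of _ 1])
  then have cont: "continuous_map (mtopology_of B) (mtopology_of B') i"
    by (rule Lipschitz_continuous_imp_continuous_map)
  show "continuous_map (mtopology_of B) euclideanreal (\<lambda>b. F (i b, 1 / real (Suc n)))" for n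
  proof -
    have "continuous_map (mtopology_of B) (half_space_topology B') (\<lambda>b. (i b, 1 / real (Suc n)))"
      using cont by (intro continuous_map_pairedI) auto
    from continuous_map_compose[OF this F] show ?thesis
      by (simp add: o_def)
  qed
  fix b assume "b \<in> topspace (mtopology_of B)"
  then have b: "b \<in> mspace B"
    by simp
  show "(\<lambda>n. F (i b, 1 / real (Suc n))) \<longlonglongrightarrow> f b"
  proof (rule tendstoI)
    fix e :: real assume "e > 0"
    \<comment> \<open>Aperture \<open>1\<close> suffices, since \<open>i b\<close> lies on the axis
      of the cone.\<close>
    then obtain d where "d > 0"
      and d: "\<And>t b'. 0 < t \<Longrightarrow> t < d \<Longrightarrow> b' \<in> mspace B' \<Longrightarrow> mdist B' (i b) b' \<le> 1 * t
                 \<Longrightarrow> \<bar>F (b', t) - f b\<bar> < e"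
      using lim b unfolding conical_limit_def by (metis zero_less_one)
    have "\<forall>\<^sub>F n in sequentially. 1 / real (Suc n) < d"
      using \<open>d > 0\<close> by (rule order_tendstoD(2)[OF lim_1_over_n[THEN LIMSEQ_Suc]])
    then show "\<forall>\<^sub>F n in sequentially. dist (F (i b, 1 / real (Suc n))) (f b) < e"
    proof eventually_elim
      case (elim n)
      have "mdist B' (i b) (i b) = 0"
        using iB[OF b] by simp
      then have "mdist B' (i b) (i b) \<le> 1 * (1 / real (Suc n))"
        by (simp only:) simp
      from d[OF _ elim iB[OF b] this] show ?case
        by (simp add: dist_real_def)
    qed
  qed
qed

section \<open>Weighted clamping\<close>

text \<open>The value is clamped before the recursive call, so index \<open>N - 1\<close> acts first
  and index \<open>0\<close> last.\<close>

primrec clamp_chain ::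
  "(nat \<Rightarrow> real) \<Rightarrow> (nat \<Rightarrow> real) \<Rightarrow> (nat \<Rightarrow> real) \<Rightarrow> nat \<Rightarrow> real \<Rightarrow> real" where
  "clamp_chain q r w 0 v = v"
| "clamp_chain q r w (Suc n) v =
     clamp_chain q r w n ((1 - w n) * v + w n * max (q n) (min (r n) v))"

text \<open>The error is a convex combination of the errors of \<open>v\<close> and of its clamp,
  and clamping to an interval around \<open>y\<close> brings no point further from
  \<open>y\<close>.\<close>

lemma weighted_clamp_nonexpansive:
  fixes a b v w y :: real
  assumes "0 \<le> w" "w \<le> 1" "a \<le> y" "y \<le> b"
  shows "\<bar>(1 - w) * v + w * max a (min b v) - y\<bar> \<le> \<bar>v - y\<bar>"
proof -
  have "(1 - w) * v + w * max a (min b v) - y = (1 - w) * (v - y) + w * (max a (min b v) - y)"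
    by (simp add: algebra_simps)
  also have "\<bar>\<dots>\<bar> \<le> (1 - w) * \<bar>v - y\<bar> + w * \<bar>max a (min b v) - y\<bar>"
    using assms(1,2) by (intro order.trans[OF abs_triangle_ineq]) (simp add: abs_mult)
  also have "\<dots> \<le> (1 - w) * \<bar>v - y\<bar> + w * \<bar>v - y\<bar>"
    using assms by (intro add_left_mono mult_left_mono) (auto simp: max_def min_def)
  finally show ?thesis
    by (simp add: algebra_simps)
qed

lemma clamp_chain_nonexpansive:
  assumes "\<And>n. n < N \<Longrightarrow> w n = 0 \<or> 0 \<le> w n \<and> w n \<le> 1 \<and> q n \<le> y \<and> y \<le> r n"
  shows "\<bar>clamp_chain q r w N v - y\<bar> \<le> \<bar>v - y\<bar>"
  using assms
proof (induction N arbitrary: v)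
  case (Suc N)
  have "\<bar>(1 - w N) * v + w N * max (q N) (min (r N) v) - y\<bar> \<le> \<bar>v - y\<bar>"
    using Suc.prems[of N] weighted_clamp_nonexpansive[of "w N" "q N" y "r N" v] by auto
  with Suc show ?case
    by (fastforce intro: order.trans)
qed simp

text \<open>Steps of weight \<open>0\<close> are identities. Thus the number of steps can depend on
  \<open>t\<close> without spoiling continuity.\<close>

lemma clamp_chain_cutoff:
  assumes "k \<le> N" "\<And>n. k \<le> n \<Longrightarrow> w n = 0"
  shows "clamp_chain q r w N v = clamp_chain q r w k v"
  using assms(1) by (induction N rule: dec_induct) (auto simp: assms(2))

lemma clamp_chain_split:
  assumes "k \<le> N"
  obtains u where "clamp_chain q r w N v = clamp_chain q r w k u"
  using assms by (induction N arbitrary: v rule: dec_induct) auto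

text \<open>The full clamp at \<open>k\<close> forgets whatever value \<open>u\<close> the larger
  indices produced, so only the indices below \<open>k\<close> need control.\<close>

lemma clamp_chain_near:
  assumes "k < N" "w k = 1" "q k \<le> y" "y \<le> r k"
    and "\<And>n. n < k \<Longrightarrow> w n = 0 \<or> 0 \<le> w n \<and> w n \<le> 1 \<and> q n \<le> y \<and> y \<le> r n"
  shows "\<bar>clamp_chain q r w N v - y\<bar> \<le> r k - q k"
proof -
  obtain u where "clamp_chain q r w N v = clamp_chain q r w (Suc k) u"
    using assms(1) by (meson Suc_leI clamp_chain_split)
  also have "\<dots> = clamp_chain q r w k (max (q k) (min (r k) u))"
    by (simp add: assms(2))
  finally have "\<bar>clamp_chain q r w N v - y\<bar> \<le> \<bar>max (q k) (min (r k) u) - y\<bar>"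
    using clamp_chain_nonexpansive[OF assms(5)] by simp
  also have "\<dots> \<le> r k - q k"
    using assms(3,4) by (auto simp: max_def min_def)
  finally show ?thesis .
qed

lemma continuous_map_clamp_chain:
  assumes "\<And>n. continuous_map X euclideanreal (w n)" "continuous_map X euclideanreal g"
  shows "continuous_map X euclideanreal (\<lambda>x. clamp_chain q r (\<lambda>n. w n x) N (g x))"
  using assms(2)
proof (induction N arbitrary: g)
  case (Suc N)
  have "continuous_map X euclideanreal
      (\<lambda>x. (1 - w N x) * g x + w N x * max (q N) (min (r N) (g x)))"
    by (intro continuous_map_add continuous_map_diff continuous_map_real_mult
        continuous_map_real_max continuous_map_real_min assms(1) Suc.prems) simp_all
  from Suc.IH[OF this] show ?case
    by simp
qed simp

section \<open>Distance to a set\<close>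

text \<open>
  The value \<open>1\<close> for the empty set makes the distance positive at points outside a closed set,
  also if that set is empty.
\<close>

definition set_mdist :: "'a metric \<Rightarrow> 'a set \<Rightarrow> 'a \<Rightarrow> real" where
  "set_mdist M A x = (if A = {} then 1 else INF a\<in>A. mdist M x a)"

lemma set_mdist_le: "a \<in> A \<Longrightarrow> set_mdist M A x \<le> mdist M x a"
  unfolding set_mdist_def by (auto intro!: cINF_lower bdd_belowI[where m = 0])

lemma set_mdist_le_add:
  assumes "A \<subseteq> mspace M" "x \<in> mspace M" "y \<in> mspace M"
  shows "set_mdist M A x \<le> set_mdist M A y + mdist M x y"
proof (cases "A = {}")
  case False
  have "set_mdist M A x - mdist M x y \<le> mdist M y a" if "a \<in> A" for a
    using set_mdist_le[OF that, of M x] mdist_triangle[of x M y a] assms that by auto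
  then have "set_mdist M A x - mdist M x y \<le> (INF a\<in>A. mdist M y a)"
    using False by (intro cINF_greatest)
  with False show ?thesis
    by (simp add: set_mdist_def)
qed (simp add: set_mdist_def)

lemma continuous_map_set_mdist:
  assumes "A \<subseteq> mspace M"
  shows "continuous_map (mtopology_of M) euclideanreal (set_mdist M A)"
proof -
  have "\<bar>set_mdist M A x - set_mdist M A y\<bar> \<le> mdist M x y"
    if "x \<in> mspace M" "y \<in> mspace M" for x y
    using set_mdist_le_add[OF assms that] set_mdist_le_add[OF assms that(2,1)]
    by (simp add: mdist_commute[of M y x])
  then have "Lipschitz_continuous_map M euclidean_metric (set_mdist M A)"
    unfolding Lipschitz_continuous_map_def
    by (auto simp: dist_real_def intro!: exI[of _ 1])
  from Lipschitz_continuous_imp_continuous_map[OF this] show ?thesis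
    by simp
qed

text \<open>A ball around \<open>b\<close> misses \<open>A\<close>, and the isometry carries its
  radius over as a lower bound. The image of \<open>A\<close> may fail to be closed in
  \<open>B'\<close>; only points \<open>i b\<close> are tested.\<close>

lemma set_mdist_image_pos:
  assumes i: "isometric_embedding B B' i" and A: "closedin (mtopology_of B) A"
    and b: "b \<in> mspace B" "b \<notin> A"
  shows "set_mdist B' (i ` A) (i b) > 0"
proof (cases "A = {}")
  case False
  obtain e where e: "e > 0" "disjnt A (mball_of B b e)" "A \<subseteq> mspace B"
    using A b Metric_space.closedin_metric[OF Metric_space_mspace_mdist, of B A]
    by (auto simp: mtopology_of_def mball_of_def)
  have "e \<le> mdist B' (i b) (i a)" if "a \<in> A" for a
  proof -
    have "e \<le> mdist B b a"
      using e that b by (auto simp: disjnt_iff)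
    with e(3) that b show ?thesis
      using i by (auto simp: isometric_embedding_def)
  qed
  then have "e \<le> set_mdist B' (i ` A) (i b)"
    using False by (auto simp: set_mdist_def intro: cINF_greatest)
  with e(1) show ?thesis
    by simp
qed (simp add: set_mdist_def)

section \<open>The extension of a Baire-1 function\<close>

text \<open>The preimage of each open interval with rational endpoints is a countable union of
  closed pieces; the triples (endpoint, endpoint, piece) are enumerated.\<close>

lemma baire1_map_closed_cover:
  fixes f :: "'a \<Rightarrow> real"
  assumes "baire1_map X euclideanreal f"
  obtains C :: "nat \<Rightarrow> 'a set" and q r :: "nat \<Rightarrow> real"
  where "\<And>n. closedin X (C n)" "\<And>n x. x \<in> C n \<Longrightarrow> q n \<le> f x \<and> f x \<le> r n"
    "\<And>x e. x \<in> topspace X \<Longrightarrow> e > 0 \<Longrightarrow> \<exists>n. x \<in> C n \<and> r n - q n < e"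
proof -
  have fsigma: "fsigma_in X {x \<in> topspace X. f x \<in> {a<..<b}}" for a b
    using assms by (auto simp: baire1_map_def)
  have "\<exists>D. (\<forall>m::nat. closedin X (D m)) \<and>
      \<Union> (range D) = {x \<in> topspace X. f x \<in> {a<..<b}}" for a b
    using fsigma[of a b] by (auto simp only: fsigma_in_ascending)
  then obtain D :: "real \<Rightarrow> real \<Rightarrow> nat \<Rightarrow> 'a set"
    where D: "\<And>a b m. closedin X (D a b m)"
      "\<And>a b. \<Union> (range (D a b)) = {x \<in> topspace X. f x \<in> {a<..<b}}"
    by metis
  define idx :: "nat \<Rightarrow> rat \<times> rat \<times> nat" where "idx = from_nat"
  define q where "q n = real_of_rat (fst (idx n))" for n
  define r where "r n = real_of_rat (fst (snd (idx n)))" for n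
  define C where "C n = D (q n) (r n) (snd (snd (idx n)))" for n
  show thesis
  proof
    show "closedin X (C n)" for n
      by (simp add: C_def D)
    show "q n \<le> f x \<and> f x \<le> r n" if "x \<in> C n" for n x
    proof -
      have "x \<in> \<Union> (range (D (q n) (r n)))"
        using that by (auto simp: C_def)
      then show ?thesis
        by (simp add: D(2))
    qed
    show "\<exists>n. x \<in> C n \<and> r n - q n < e" if x: "x \<in> topspace X" and "e > 0" for x e
    proof -
      obtain a where a: "f x - e / 2 < real_of_rat a" "real_of_rat a < f x"
        using of_rat_dense[of "f x - e / 2" "f x"] \<open>e > 0\<close> by auto
      obtain b where b: "f x < real_of_rat b" "real_of_rat b < f x + e / 2"
        using of_rat_dense[of "f x" "f x + e / 2"] \<open>e > 0\<close> by auto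
      have "x \<in> \<Union> (range (D (real_of_rat a) (real_of_rat b)))"
        using x a b by (simp add: D(2))
      then obtain m where m: "x \<in> D (real_of_rat a) (real_of_rat b) m"
        by blast
      have "idx (to_nat (a, b, m)) = (a, b, m)"
        by (simp add: idx_def)
      then show ?thesis
        using a b m by (intro exI[of _ "to_nat (a, b, m)"]) (simp add: C_def q_def r_def)
    qed
  qed
qed

text \<open>Meant for a chain whose length jumps with \<open>t\<close>: locally it agrees with a
  chain of fixed length.\<close>

lemma continuous_map_locally_eq:
  assumes "\<And>x. x \<in> topspace X \<Longrightarrow>
    \<exists>U g. openin X U \<and> x \<in> U \<and> continuous_map X Y g \<and> (\<forall>y\<in>U. f y = g y)"
  shows "continuous_map X Y f"
  unfolding continuous_map_eq_topcontinuous_at topcontinuous_at_def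
proof (intro ballI conjI allI impI)
  fix x assume x: "x \<in> topspace X"
  from assms[OF x] obtain U g where U: "openin X U" "x \<in> U" "\<And>y. y \<in> U \<Longrightarrow> f y = g y"
    and g: "continuous_map X Y g"
    by blast
  show "x \<in> topspace X"
    by fact
  have "f y \<in> topspace Y" if "y \<in> topspace X" for y
    using assms[OF that] that by (auto simp: continuous_map_def Pi_iff)
  then show "f \<in> topspace X \<rightarrow> topspace Y"
    by blast
  fix V assume "openin Y V \<and> f x \<in> V"
  then have "openin X (U \<inter> {y \<in> topspace X. g y \<in> V})" "f x \<in> V"
    using U(1) g by (auto simp: continuous_map_def)
  then show "\<exists>U. openin X U \<and> x \<in> U \<and> (\<forall>y\<in>U. f y \<in> V)"
    using U x by (intro exI[of _ "U \<inter> {y \<in> topspace X. g y \<in> V}"]) auto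
qed

lemma conical_limit_if_baire1_map:
  assumes i: "isometric_embedding B B' i"
    and f: "baire1_map (mtopology_of B) euclideanreal f"
  shows "\<exists>F. continuous_map (half_space_topology B') euclideanreal F \<and> conical_limit B B' i f F"
proof -
  obtain C :: "nat \<Rightarrow> 'a set" and q r :: "nat \<Rightarrow> real"
    where C: "\<And>n. closedin (mtopology_of B) (C n)"
      and qr: "\<And>n x. x \<in> C n \<Longrightarrow> q n \<le> f x \<and> f x \<le> r n"
      and small: "\<And>x e. x \<in> topspace (mtopology_of B) \<Longrightarrow> e > 0 \<Longrightarrow> \<exists>n. x \<in> C n \<and> r n - q n < e"
    using baire1_map_closed_cover[OF f] by metis
  have iB: "i b \<in> mspace B'" if "b \<in> mspace B" for b
    using i that by (auto simp: isometric_embedding_def)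
  have iC: "i ` C n \<subseteq> mspace B'" for n
    using iB closedin_subset[OF C[of n]] by auto
  define d where "d n = set_mdist B' (i ` C n)" for n
  \<comment> \<open>The scale \<open>sqrt t\<close> lies between the cone width \<open>c * t\<close>
    and a constant: the quotient tends to \<open>0\<close> in cones over points of
    \<open>C n\<close> and to infinity over other points of \<open>B\<close>.\<close>
  define w where "w n p = max 0 (min 1 (2 - d n (fst p) / sqrt (snd p) - real n * snd p))" for n p
  \<comment> \<open>All steps from \<open>N t\<close> on have weight \<open>0\<close>, so nothing is
    lost by stopping there.\<close>
  define N where "N t = nat \<lceil>2 / t\<rceil>" for t :: real
  define F where "F p = clamp_chain q r (\<lambda>n. w n p) (N (snd p)) 0" for p
  have d_nonneg: "d n y \<ge> 0" for n y
    unfolding d_def set_mdist_def by (auto intro: cINF_greatest)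
  have w01: "0 \<le> w n p" "w n p \<le> 1" for n p
    by (auto simp: w_def)
  have w_cutoff: "w n (y, t) = 0" if "t > 0" "2 / t \<le> real n" for n y t
  proof -
    have "real n * t \<ge> 2"
      using that by (simp add: field_simps)
    moreover have "d n y / sqrt t \<ge> 0"
      using d_nonneg that(1) by simp
    ultimately show ?thesis
      by (simp add: w_def)
  qed

  have fst: "continuous_map (half_space_topology B') (mtopology_of B') fst"
    by (rule continuous_map_fst)
  have snd: "continuous_map (half_space_topology B') euclideanreal snd"
    using continuous_map_snd by (rule continuous_map_into_fulltopology)
  have sqrt: "continuous_map (half_space_topology B') euclideanreal (\<lambda>p. sqrt (snd p))"
    using continuous_map_compose[OF snd, of euclideanreal sqrt]
    by (simp add: o_def continuous_on_real_sqrt continuous_on_id)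
  have w_cont: "continuous_map (half_space_topology B') euclideanreal (w n)" for n
  proof -
    have "continuous_map (half_space_topology B') euclideanreal (\<lambda>p. d n (fst p))"
      using continuous_map_compose[OF fst continuous_map_set_mdist[OF iC]]
      by (simp add: o_def d_def)
    then show ?thesis
      unfolding w_def using sqrt snd by (auto intro!: continuous_intros)
  qed
  have "continuous_map (half_space_topology B') euclideanreal F"
  proof (rule continuous_map_locally_eq)
    fix p assume p: "p \<in> topspace (half_space_topology B')"
    \<comment> \<open>On the neighbourhood \<open>t > s\<close> of \<open>p\<close>,
      \<open>N s\<close> steps are enough for all points at once.\<close>
    define s where "s = snd p / 2"
    have s: "s > 0" "snd p > s"
      using p by (auto simp: s_def)
    let ?U = "{x \<in> topspace (half_space_topology B'). snd x \<in> {s<..}}"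
    let ?g = "\<lambda>x. clamp_chain q r (\<lambda>n. w n x) (N s) 0"
    have "openin (half_space_topology B') ?U"
      using snd by (rule openin_continuous_map_preimage) simp
    moreover have "continuous_map (half_space_topology B') euclideanreal ?g"
      using w_cont by (intro continuous_map_clamp_chain) auto
    moreover have "F x = ?g x" if "x \<in> ?U" for x
    proof -
      have x: "snd x > s"
        using that by simp
      then have "2 / snd x \<le> 2 / s"
        using s(1) by (simp add: frac_le)
      then have "N (snd x) \<le> N s"
        unfolding N_def by (intro nat_mono ceiling_mono)
      moreover have "w n x = 0" if "N (snd x) \<le> n" for n
      proof -
        have "2 / snd x \<le> real n"
          using that by (simp add: N_def ceiling_le_iff nat_le_iff)
        then show ?thesis
          using w_cutoff[of "snd x" n "fst x"] x s(1) by simp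
      qed
      ultimately show ?thesis
        unfolding F_def by (intro clamp_chain_cutoff[symmetric])
    qed
    ultimately show "\<exists>U g. openin (half_space_topology B') U \<and> p \<in> U \<and>
        continuous_map (half_space_topology B') euclideanreal g \<and> (\<forall>x\<in>U. F x = g x)"
      using p s by (intro exI[of _ ?U] exI[of _ ?g]) auto
  qed
  moreover have "conical_limit B B' i f F"
    unfolding conical_limit_def
  proof (intro ballI allI impI)
    fix b and c e :: real assume b: "b \<in> mspace B" and "c > 0" "e > 0"
    define cone where "cone t = {b' \<in> mspace B'. mdist B' (i b) b' \<le> c * t}" for t
    have w_1: "\<forall>\<^sub>F t in at_right 0. \<forall>b'\<in>cone t. w n (b', t) = 1" if "b \<in> C n" for n
    proof -
      \<comment> \<open>In the cone \<open>d n b' / sqrt t\<close> is at most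
        \<open>c * sqrt t\<close>, so a sum below \<open>1\<close> makes the weight
        \<open>1\<close>.\<close>
      have "((\<lambda>t. c * sqrt t + real n * t) \<longlongrightarrow> c * sqrt 0 + real n * 0) (at_right 0)"
        by (intro tendsto_intros)
      then have "\<forall>\<^sub>F t in at_right 0. c * sqrt t + real n * t < 1"
        by (rule order_tendstoD) simp
      with eventually_at_right_less show ?thesis
      proof eventually_elim
        case (elim t)
        show ?case
        proof
          fix b' assume "b' \<in> cone t"
          then have "d n b' \<le> c * t"
            using set_mdist_le[of "i b" "i ` C n" B' b'] that
            by (simp add: d_def cone_def mdist_commute[of B' b'])
          then have "d n b' / sqrt t \<le> c * t / sqrt t"
            using elim by (intro divide_right_mono) auto
          also have "c * t / sqrt t = c * sqrt t"
            using elim by (simp add: real_div_sqrt flip: times_divide_eq_right)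
          finally show "w n (b', t) = 1"
            using elim by (simp add: w_def)
        qed
      qed
    qed
    have w_0: "\<forall>\<^sub>F t in at_right 0. \<forall>b'\<in>cone t. w n (b', t) = 0" if "b \<notin> C n" for n
    proof -
      have pos: "d n (i b) > 0"
        unfolding d_def by (rule set_mdist_image_pos[OF i C b that])
      \<comment> \<open>Moving from \<open>i b\<close> to \<open>b'\<close> costs at most
        \<open>c * t\<close>; what remains of \<open>d n (i b)\<close> must be at least
        \<open>2 * sqrt t\<close>.\<close>
      have "((\<lambda>t. c * t + 2 * sqrt t) \<longlongrightarrow> c * 0 + 2 * sqrt 0) (at_right 0)"
        by (intro tendsto_intros)
      then have "\<forall>\<^sub>F t in at_right 0. c * t + 2 * sqrt t < d n (i b)"
        by (rule order_tendstoD) (simp add: pos)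
      with eventually_at_right_less show ?thesis
      proof eventually_elim
        case (elim t)
        show ?case
        proof
          fix b' assume "b' \<in> cone t"
          then have "d n (i b) \<le> d n b' + c * t"
            using set_mdist_le_add[OF iC iB[OF b], of b' n] by (auto simp: d_def cone_def)
          then have "2 * sqrt t \<le> d n b'"
            using elim by simp
          then have "2 \<le> d n b' / sqrt t"
            using elim by (simp add: field_simps)
          moreover have "0 \<le> real n * t"
            using elim by simp
          ultimately show "w n (b', t) = 0"
            by (simp add: w_def)
        qed
      qed
    qed
    obtain k where k: "b \<in> C k" "r k - q k < e"
      using small[of b e] b \<open>e > 0\<close> by auto
    \<comment> \<open>A common threshold exists because only finitely many indices precede
      \<open>k\<close>.\<close>
    have "\<forall>\<^sub>F t in at_right 0. \<forall>n\<in>{..<k}. \<forall>b'\<in>cone t. b \<notin> C n \<longrightarrow> w n (b', t) = 0"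
      using w_0 by (intro eventually_ball_finite) (auto elim: eventually_mono)
    with w_1[OF k(1)] eventually_at_right_less
    have "\<forall>\<^sub>F t in at_right 0. \<forall>b'\<in>cone t. \<bar>F (b', t) - f b\<bar> < e"
    proof eventually_elim
      case (elim t)
      show ?case
      proof
        fix b' assume b': "b' \<in> cone t"
        \<comment> \<open>Step \<open>k\<close> is really performed: its weight is \<open>1\<close>,
          while weights beyond the cutoff vanish.\<close>
        have "k < N t"
        proof (rule ccontr)
          assume "\<not> k < N t"
          then have "2 / t \<le> real k"
            by (simp add: N_def ceiling_le_iff nat_le_iff not_less)
          with w_cutoff[of t k b'] elim b' show False
            by simp
        qed
        then have "\<bar>F (b', t) - f b\<bar> \<le> r k - q k"
          unfolding F_def snd_conv
        proof (rule clamp_chain_near)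
          show "w k (b', t) = 1" "q k \<le> f b" "f b \<le> r k"
            using elim b' qr[OF k(1)] by auto
          show "w n (b', t) = 0 \<or> 0 \<le> w n (b', t) \<and> w n (b', t) \<le> 1 \<and> q n \<le> f b \<and> f b \<le> r n"
            if "n < k" for n
            using elim b' qr[of b n] w01 that by (cases "b \<in> C n") auto
        qed
        with k(2) show "\<bar>F (b', t) - f b\<bar> < e"
          by simp
      qed
    qed
    then show "\<exists>\<delta>>0. \<forall>t b'. 0 < t \<and> t < \<delta> \<and> b' \<in> mspace B' \<and> mdist B' (i b) b' \<le> c * t
        \<longrightarrow> \<bar>F (b', t) - f b\<bar> < e"
      by (auto simp: eventually_at_right_field cone_def)
  qed
  ultimately show ?thesis
    by blast
qed

section \<open>Equivalence of the conditions\<close>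

lemma baire1_map_iff_conical_limit:
  assumes "isometric_embedding B B' i"
  shows "baire1_map (mtopology_of B) euclideanreal f \<longleftrightarrow>
    (\<exists>F. continuous_map (half_space_topology B') euclideanreal F \<and> conical_limit B B' i f F)"
  using conical_limit_if_baire1_map[OF assms] baire1_map_if_conical_limit[OF assms] by blast

lemma isometric_embedding_Inl:
  fixes B :: "'a metric"
  obtains B' :: "('a + 'c) metric" where "isometric_embedding B B' Inl"
proof
  \<comment> \<open>\<open>projl\<close> is unspecified on \<open>Inr\<close> points, but these lie
    outside the carrier.\<close>
  let ?d = "\<lambda>x y :: 'a + 'c. mdist B (projl x) (projl y)"
  interpret Metric_space "Inl ` mspace B" ?d
    by unfold_locales (auto simp: mdist_commute mdist_triangle)
  show "isometric_embedding B (metric (Inl ` mspace B, ?d)) Inl"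
    by (simp add: isometric_embedding_def)
qed

theorem theoremB:
  fixes B :: "'a metric" and f :: "'a \<Rightarrow> real"
  defines "cond_a \<equiv> baire1_map (mtopology_of B) euclideanreal f"
    and "cond_b \<equiv> (\<exists>F. continuous_map (half_space_topology B) euclideanreal F
                        \<and> conical_limit B B id f F)"
    and "cond_c \<equiv> (\<exists>(B' :: ('a + 'c) metric) i. isometric_embedding B B' i \<and>
                     (\<exists>F. continuous_map (half_space_topology B') euclideanreal F
                        \<and> conical_limit B B' i f F))"
    and "cond_c' \<equiv> (\<forall>(B' :: ('a + 'c) metric) i. isometric_embedding B B' i \<longrightarrow>
                     (\<exists>F. continuous_map (half_space_topology B') euclideanreal F
                        \<and> conical_limit B B' i f F))"
  shows "(cond_a \<longleftrightarrow> cond_b) \<and> (cond_a \<longleftrightarrow> cond_c) \<and> (cond_a \<longleftrightarrow> cond_c')"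
proof -
  have "isometric_embedding B B id"
    by (simp add: isometric_embedding_def)
  then have "cond_a \<longleftrightarrow> cond_b"
    unfolding cond_a_def cond_b_def by (rule baire1_map_iff_conical_limit)
  moreover obtain B' :: "('a + 'c) metric" where "isometric_embedding B B' Inl"
    by (rule isometric_embedding_Inl)
  \<comment> \<open>The extension property is equivalent to (a) for each embedding separately; the
    copy \<open>Inl\<close> of \<open>B\<close> keeps the quantifiers from being vacuous.\<close>
  then have "cond_a \<longleftrightarrow> cond_c" "cond_a \<longleftrightarrow> cond_c'"
    unfolding cond_a_def cond_c_def cond_c'_def
    using baire1_map_iff_conical_limit[where B = B and f = f] by blast+
  ultimately show ?thesis
    by blast
qed

end
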